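(* Let $\alpha : \mathfrak{A} \to \mathfrak{B}$ be a de Vries extension. Then the following are equivalent. (1) The space $X_{\mathfrak{B}}$ (the set of atoms of $\mathfrak B$ with the topology $\tau_\alpha$) is locally compact. (2) For each $b \in \mathfrak{A}$ we have $\alpha(b) = \bigvee \{ \alpha(a) \mid a \in I_\alpha,\ a \prec b \}$. (3) $I_\alpha$ is a round ideal of $\mathfrak A$ with $\bigvee \alpha[I_\alpha] = 1$.
   Context: A de Vries algebra is a pair $\mathfrak A=(A,\prec)$, where $A$ is a complete Boolean algebra and $\prec$ is a binary relation on $A$ with: (DV1) $1\prec 1$; (DV2) $a\prec b$ implies $a\le b$; (DV3) $a\le b\prec c\le d$ implies $a\prec d$; (DV4) $a\prec b,c$ implies $a\prec b\wedge c$; (DV5) $a\prec b$ implies $\neg b\prec\neg a$; (DV6) $a\prec b$ implies there is $c$ with $a\prec c\prec b$; (DV7) $b=\bigvee\{a\in A\mid a\prec b\}$. A de Vries morphism $\rho:\mathfrak A\to\mathfrak B$ is a map with: (M1) $\rho(0)=0$; (M2) $\rho(a\wedge b)=\rho(a)\wedge\rho(b)$; (M3) $a\prec b$ implies $\neg\rho(\neg a)\prec\rho(b)$; (M4) $\rho(b)=\bigvee\{\rho(a)\mid a\prec b\}$. A de Vries algebra is extremally disconnected if $a\prec b$ iff $a\le b$, and atomic if $A$ is an atomic Boolean algebra. A de Vries extension is a one-to-one de Vries morphism $\alpha:\mathfrak A\to\mathfrak B$ with $\mathfrak B$ atomic and extremally disconnected such that every element of $\mathfrak B$ is a join of meets of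 elements of $\alpha[\mathfrak A]$. A filter $F$ of $\mathfrak A$ is round if for each $b\in F$ there is $a\in F$ with $a\prec b$; an ideal $I$ is round if for each $a\in I$ there is $b\in I$ with $a\prec b$. An end of $\mathfrak A$ is a maximal proper round filter. $Y_{\mathfrak A}$ is the set of ends of $\mathfrak A$ with the topology having as basis the sets $\zeta_{\mathfrak A}(a)=\{x\in Y_{\mathfrak A}\mid a\in x\}$, $a\in\mathfrak A$; it is compact Hausdorff. For a de Vries extension $\alpha:\mathfrak A\to\mathfrak B$, $X_{\mathfrak B}$ is the set of atoms of $\mathfrak B$, and $\alpha_*:X_{\mathfrak B}\to Y_{\mathfrak A}$ is $\alpha_*(b)=\{a\in\mathfrak A\mid \exists c\prec a \text{ with } b\le\alpha(c)\}$; it is one-to-one. $X_{\mathfrak B}$ carries the least topology $\tau_\alpha$ making $\alpha_*$ continuous, and then $\alpha_*:X_{\mathfrak B}\to Y_{\mathfrak A}$ is a compactification. An element $a\in\mathfrak A$ is $\alpha$-compact if whenever $\neg\alpha(\neg a)\le\bigvee\alpha[S]$ for some $S\subseteq\mathfrak A$, there is a finite $T\subseteq S$ with $\neg\alpha(\neg a)\le\bigvee\alpha[T]$. $I_\alpha$ denotes the set of $\alpha$-compact elements of $\mathfrak A$. *)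

theory Defs
  imports "HOL-Analysis.Analysis"
begin

no_notation lesspoll  (infixl "\<prec>" 50)

text \<open>
  Complete Boolean algebras are types of sort \<open>{complete_lattice, boolean_algebra}\<close>.  The class
  \<open>complete_boolean_algebra\<close> of \<open>Complete_Lattices\<close> is not suitable here: it demands complete
  distributivity, which forces the algebra to be atomic.
\<close>

locale de_vries_algebra =
  fixes prec :: "'a::{complete_lattice, boolean_algebra} \<Rightarrow> 'a \<Rightarrow> bool"  (infix "\<prec>" 50)
  assumes DV1: "top \<prec> top"
    and DV2: "a \<prec> b \<Longrightarrow> a \<le> b"
    and DV3: "a \<le> b \<Longrightarrow> b \<prec> c \<Longrightarrow> c \<le> d \<Longrightarrow> a \<prec> d"
    and DV4: "a \<prec> b \<Longrightarrow> a \<prec> c \<Longrightarrow> a \<prec> inf b c"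
    and DV5: "a \<prec> b \<Longrightarrow> - b \<prec> - a"
    and DV6: "a \<prec> b \<Longrightarrow> \<exists>c. a \<prec> c \<and> c \<prec> b"
    and DV7: "b = Sup {a. a \<prec> b}"

locale de_vries_morphism =
  A: de_vries_algebra precA + B: de_vries_algebra precB
  for precA :: "'a::{complete_lattice, boolean_algebra} \<Rightarrow> 'a \<Rightarrow> bool"  (infix "\<prec>\<^sub>A" 50)
    and precB :: "'b::{complete_lattice, boolean_algebra} \<Rightarrow> 'b \<Rightarrow> bool"  (infix "\<prec>\<^sub>B" 50) +
  fixes \<rho> :: "'a \<Rightarrow> 'b"
  assumes M1: "\<rho> bot = bot"
    and M2: "\<rho> (inf a b) = inf (\<rho> a) (\<rho> b)"
    and M3: "a \<prec>\<^sub>A b \<Longrightarrow> - \<rho> (- a) \<prec>\<^sub>B \<rho> b"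
    and M4: "\<rho> b = Sup (\<rho> ` {a. a \<prec>\<^sub>A b})"

definition extremally_disconnected ::
    "('a::{complete_lattice, boolean_algebra} \<Rightarrow> 'a \<Rightarrow> bool) \<Rightarrow> bool" where
  "extremally_disconnected prec \<longleftrightarrow> (\<forall>a b. prec a b \<longleftrightarrow> a \<le> b)"

definition atoms :: "'a::boolean_algebra set" where
  "atoms = {x. x \<noteq> bot \<and> (\<forall>y\<le>x. y = bot \<or> y = x)}"

definition atomic_algebra :: "'a::boolean_algebra itself \<Rightarrow> bool" where
  "atomic_algebra _ \<longleftrightarrow> (\<forall>y::'a. y \<noteq> bot \<longrightarrow> (\<exists>x\<in>atoms. x \<le> y))"

locale de_vries_extension =
  de_vries_morphism precA precB \<alpha>
  for precA :: "'a::{complete_lattice, boolean_algebra} \<Rightarrow> 'a \<Rightarrow> bool"  (infix "\<prec>\<^sub>A" 50)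
    and precB :: "'b::{complete_lattice, boolean_algebra} \<Rightarrow> 'b \<Rightarrow> bool"  (infix "\<prec>\<^sub>B" 50)
    and \<alpha> :: "'a \<Rightarrow> 'b" +
  assumes inj: "inj \<alpha>"
    and atomic: "atomic_algebra TYPE('b)"
    and extremally_disconnected: "extremally_disconnected precB"
    and join_of_meets: "\<exists>\<S> \<subseteq> Pow (range \<alpha>). y = Sup (Inf ` \<S>)"

definition lattice_filter :: "'a::boolean_algebra set \<Rightarrow> bool" where
  "lattice_filter F \<longleftrightarrow>
     F \<noteq> {} \<and> (\<forall>a\<in>F. \<forall>b. a \<le> b \<longrightarrow> b \<in> F) \<and> (\<forall>a\<in>F. \<forall>b\<in>F. inf a b \<in> F)"

definition lattice_ideal :: "'a::boolean_algebra set \<Rightarrow> bool" where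
  "lattice_ideal I \<longleftrightarrow>
     I \<noteq> {} \<and> (\<forall>b\<in>I. \<forall>a. a \<le> b \<longrightarrow> a \<in> I) \<and> (\<forall>a\<in>I. \<forall>b\<in>I. sup a b \<in> I)"

definition round_filter :: "('a::boolean_algebra \<Rightarrow> 'a \<Rightarrow> bool) \<Rightarrow> 'a set \<Rightarrow> bool" where
  "round_filter prec F \<longleftrightarrow> lattice_filter F \<and> (\<forall>b\<in>F. \<exists>a\<in>F. prec a b)"

definition round_ideal :: "('a::boolean_algebra \<Rightarrow> 'a \<Rightarrow> bool) \<Rightarrow> 'a set \<Rightarrow> bool" where
  "round_ideal prec I \<longleftrightarrow> lattice_ideal I \<and> (\<forall>a\<in>I. \<exists>b\<in>I. prec a b)"

definition ends :: "('a::boolean_algebra \<Rightarrow> 'a \<Rightarrow> bool) \<Rightarrow> 'a set set" where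
  "ends prec = {F. round_filter prec F \<and> F \<noteq> UNIV \<and>
     (\<forall>G. round_filter prec G \<and> G \<noteq> UNIV \<and> F \<subseteq> G \<longrightarrow> G = F)}"

definition zeta :: "('a::boolean_algebra \<Rightarrow> 'a \<Rightarrow> bool) \<Rightarrow> 'a \<Rightarrow> 'a set set" where
  "zeta prec a = {x \<in> ends prec. a \<in> x}"

definition end_space :: "('a::boolean_algebra \<Rightarrow> 'a \<Rightarrow> bool) \<Rightarrow> 'a set topology" where
  "end_space prec = topology_generated_by (range (zeta prec))"

definition dual_map ::
    "('a::boolean_algebra \<Rightarrow> 'a \<Rightarrow> bool) \<Rightarrow> ('a \<Rightarrow> 'b::boolean_algebra) \<Rightarrow> 'b \<Rightarrow> 'a set" where
  "dual_map prec \<alpha> b = {a. \<exists>c. prec c a \<and> b \<le> \<alpha> c}"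

definition atom_space ::
    "('a::boolean_algebra \<Rightarrow> 'a \<Rightarrow> bool) \<Rightarrow> ('a \<Rightarrow> 'b::boolean_algebra) \<Rightarrow> 'b topology" where
  "atom_space prec \<alpha> = pullback_topology atoms (dual_map prec \<alpha>) (end_space prec)"

definition compact_elements ::
    "('a::{complete_lattice, boolean_algebra} \<Rightarrow> 'b::{complete_lattice, boolean_algebra}) \<Rightarrow> 'a set"
  where "compact_elements \<alpha> = {a. \<forall>S. - \<alpha> (- a) \<le> Sup (\<alpha> ` S) \<longrightarrow>
           (\<exists>T\<subseteq>S. finite T \<and> - \<alpha> (- a) \<le> Sup (\<alpha> ` T))}"

text \<open>
  \<^const>\<open>end_space\<close> is specified by a subbase; the next two lemmas show that the sets
  \<^const>\<open>zeta\<close> form a base of it and that its points are all the ends.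
\<close>

lemma lattice_filter_inf_iff:
  "lattice_filter F \<Longrightarrow> inf a b \<in> F \<longleftrightarrow> a \<in> F \<and> b \<in> F"
  unfolding lattice_filter_def by (meson inf.cobounded1 inf.cobounded2)

lemma lattice_filter_top: "lattice_filter F \<Longrightarrow> top \<in> F"
  unfolding lattice_filter_def by (meson ex_in_conv top_greatest)

lemma zeta_inf: "zeta prec (inf a b) = zeta prec a \<inter> zeta prec b"
  by (auto simp: zeta_def ends_def round_filter_def lattice_filter_inf_iff)

lemma zeta_top: "zeta prec top = ends prec"
  by (auto simp: zeta_def ends_def round_filter_def lattice_filter_top)

lemma topspace_end_space: "topspace (end_space prec) = ends prec"
proof -
  have "\<Union> (range (zeta prec)) = ends prec"
    using zeta_top[of prec] by (auto simp: zeta_def)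
  then show ?thesis
    by (simp add: end_space_def)
qed

lemma openin_end_space:
  "openin (end_space prec) U \<longleftrightarrow> (\<exists>S. U = (\<Union>a\<in>S. zeta prec a))"
proof
  assume "openin (end_space prec) U"
  then have "generate_topology_on (range (zeta prec)) U"
    by (simp add: end_space_def openin_topology_generated_by_iff)
  then show "\<exists>S. U = (\<Union>a\<in>S. zeta prec a)"
  proof induction
    case Empty
    show ?case by (rule exI[of _ "{}"]) simp
  next
    case (Int V W)
    then obtain S T where "V = (\<Union>a\<in>S. zeta prec a)" "W = (\<Union>a\<in>T. zeta prec a)" by blast
    then have "V \<inter> W = (\<Union>c\<in>{inf a b |a b. a \<in> S \<and> b \<in> T}. zeta prec c)"
      by (fastforce simp: zeta_inf)
    then show ?case by blast
  next
    case (UN K)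
    then obtain S where "\<And>V. V \<in> K \<Longrightarrow> V = (\<Union>a\<in>S V. zeta prec a)" by metis
    then have "\<Union>K = (\<Union>a\<in>(\<Union>V\<in>K. S V). zeta prec a)" by auto
    then show ?case by blast
  next
    case (Basis V)
    then obtain a where "V = zeta prec a" by blast
    then show ?case by (intro exI[of _ "{a}"]) simp
  qed
next
  have "openin (end_space prec) (zeta prec a)" for a
    by (simp add: end_space_def topology_generated_by_Basis)
  moreover assume "\<exists>S. U = (\<Union>a\<in>S. zeta prec a)"
  ultimately show "openin (end_space prec) U" by blast
qed

text \<open>
  The carrier of \<^const>\<open>pullback_topology\<close> drops the points that are mapped outside the target
  space.  Here nothing is dropped, since the dual map sends every atom to an end.
\<close>

context de_vries_extension
begin

lemma mono: "a \<le> b \<Longrightarrow> \<alpha> a \<le> \<alpha> b"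
  by (metis M2 inf.absorb_iff1)

lemma top: "\<alpha> top = top"
  using M3[OF A.DV1] M1 B.DV2 by (metis compl_bot_eq compl_top_eq top.extremum_uniqueI)

lemma dual_map_in_ends:
  assumes b: "b \<in> atoms"
  shows "dual_map precA \<alpha> b \<in> ends precA"
proof -
  let ?F = "dual_map precA \<alpha> b"
  have b0: "b \<noteq> bot" and bmin: "\<And>y. y \<le> b \<Longrightarrow> y = bot \<or> y = b"
    using b by (auto simp: atoms_def)
  have "top \<in> ?F"
    using A.DV1 top unfolding dual_map_def by auto
  moreover have "a' \<in> ?F" if "a \<in> ?F" "a \<le> a'" for a a'
    using that A.DV3[of _ _ a a'] unfolding dual_map_def by blast
  moreover have "inf a a' \<in> ?F" if aa': "a \<in> ?F" "a' \<in> ?F" for a a'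
  proof -
    obtain c c' where c: "c \<prec>\<^sub>A a" "b \<le> \<alpha> c" and c': "c' \<prec>\<^sub>A a'" "b \<le> \<alpha> c'"
      using aa' unfolding dual_map_def by blast
    have "inf c c' \<prec>\<^sub>A inf a a'"
      using A.DV3[OF _ c(1), of "inf c c'" a] A.DV3[OF _ c'(1), of "inf c c'" a'] A.DV4 by simp
    moreover have "b \<le> \<alpha> (inf c c')" using c c' by (simp add: M2)
    ultimately show ?thesis unfolding dual_map_def by blast
  qed
  moreover have "\<exists>d\<in>?F. d \<prec>\<^sub>A a" if "a \<in> ?F" for a
    using that A.DV6 unfolding dual_map_def by blast
  ultimately have "round_filter precA ?F"
    unfolding round_filter_def lattice_filter_def by blast
  moreover have "bot \<notin> ?F"
  proof
    assume "bot \<in> ?F"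
    then obtain c where "c \<prec>\<^sub>A bot" "b \<le> \<alpha> c" unfolding dual_map_def by blast
    moreover have "c = bot" using A.DV2[OF \<open>c \<prec>\<^sub>A bot\<close>] by (simp add: bot_unique)
    ultimately show False using M1 b0 by (simp add: bot_unique)
  qed
  moreover have "G = ?F" if G: "round_filter precA G" "G \<noteq> UNIV" "?F \<subseteq> G" for G
  proof
    have filt: "lattice_filter G" and rnd: "\<And>a. a \<in> G \<Longrightarrow> \<exists>c\<in>G. c \<prec>\<^sub>A a"
      using G(1) unfolding round_filter_def by auto
    have botG: "bot \<notin> G"
      using filt G(2) unfolding lattice_filter_def by auto
    show "G \<subseteq> ?F"
    proof
      fix a assume "a \<in> G"
      then obtain c d e where "c \<in> G" "d \<in> G" "e \<in> G" and cde: "c \<prec>\<^sub>A a" "d \<prec>\<^sub>A c" "e \<prec>\<^sub>A d"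
        using rnd by meson
      have "b \<le> \<alpha> c"
      proof (rule ccontr)
        assume "\<not> b \<le> \<alpha> c"
        then have "inf b (\<alpha> c) = bot"
          using bmin[of "inf b (\<alpha> c)"] by (metis inf.cobounded1 inf.orderI)
        then have "b \<le> - \<alpha> c" by (simp add: inf_shunt)
        also have "\<dots> \<le> \<alpha> (- d)"
          using B.DV2[OF M3[OF cde(2)]] compl_le_swap2 by blast
        finally have "- e \<in> ?F"
          using A.DV5[OF cde(3)] unfolding dual_map_def by blast
        then have "inf e (- e) \<in> G"
          using \<open>e \<in> G\<close> G(3) filt unfolding lattice_filter_def by blast
        then show False using botG by simp
      qed
      then show "a \<in> ?F" using cde(1) unfolding dual_map_def by blast
    qed
  qed (use G in blast)
  ultimately show ?thesis unfolding ends_def by blast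
qed

lemma topspace_atom_space: "topspace (atom_space precA \<alpha>) = atoms"
  using dual_map_in_ends
  by (auto simp: atom_space_def topspace_pullback_topology topspace_end_space)

end

end

theory Submission
  imports Defs
begin

text \<open>
  In an atomic complete Boolean algebra an element \<open>y\<close> is determined by the set of atoms below it,
  and this assignment turns joins into unions and complements into complements.  Writing \<open>O a\<close> for
  the atoms below \<open>\<alpha> a\<close> and \<open>C a\<close> for the atoms below \<open>- \<alpha> (- a)\<close>, all three conditions become
  statements about the space of atoms: by M4 the sets \<open>O a\<close> are a base of its topology (lemma
  \<open>openin_atom_space\<close>), \<open>C a\<close> is a closed set that contains \<open>O a\<close>, and \<open>a \<prec> b\<close> forces
  \<open>C a \<subseteq> O b\<close> by M3.  An \<open>\<alpha>\<close>-compact element is then an \<open>a\<close> for which every cover of \<open>C a\<close> by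
  basic open sets has a finite subcover, that is, for which \<open>C a\<close> is compact (lemma
  \<open>compact_element_iff_compactin\<close>).

  If the space is locally compact and the atom \<open>x\<close> lies below \<open>\<alpha> b\<close>, a compact neighbourhood of \<open>x\<close>
  contains some \<open>O a\<close> with \<open>x \<in> O a\<close>; an element \<open>c \<prec> a \<sqinter> b\<close> with \<open>x \<in> O c\<close> has \<open>C c\<close> closed in a
  compact set, so \<open>c\<close> is compact.  Hence \<open>\<alpha> b\<close> is the join of the \<open>\<alpha> c\<close> with \<open>c \<prec> b\<close> compact.

  Suppose every \<open>\<alpha> b\<close> is such a join.  For \<open>b = 1\<close> this says that the sets \<open>O t\<close> with \<open>t\<close> compact
  cover the space.  The compact elements always form an ideal.  So if \<open>a\<close> is compact, then a finite
  subcover of \<open>C a\<close> gives one compact \<open>t\<close> with \<open>C a \<subseteq> O t\<close>; for compact \<open>a\<close> this inclusion gives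
  back \<open>a \<prec> t\<close> (lemma \<open>compact_element_prec\<close>), and the ideal is round.

  Finally, if the \<open>O a\<close> with \<open>a\<close> compact cover the space, then the sets \<open>C a\<close> are compact
  neighbourhoods of its points, and the space is locally compact.
\<close>

section \<open>Elements of an atomic Boolean algebra as sets of atoms\<close>

definition atoms_below :: "'b::boolean_algebra \<Rightarrow> 'b set" where
  "atoms_below y = {x \<in> atoms. x \<le> y}"

lemma atoms_below_subset: "atoms_below y \<subseteq> atoms"
  by (auto simp: atoms_below_def)

lemma atoms_below_inf: "atoms_below (inf y z) = atoms_below y \<inter> atoms_below z"
  by (auto simp: atoms_below_def)

lemma atoms_below_uminus: "atoms_below (- y) = atoms - atoms_below y"
proof -
  have "x \<le> - y \<longleftrightarrow> \<not> x \<le> y" if "x \<in> atoms" for x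
  proof -
    have x0: "x \<noteq> bot" and cases: "inf x y = bot \<or> inf x y = x"
      using that by (auto simp: atoms_def)
    have "x \<le> - y \<longleftrightarrow> inf x y = bot" by (simp add: inf_shunt)
    moreover have "x \<le> y \<longleftrightarrow> inf x y = x" by (simp add: inf.absorb_iff1)
    ultimately show ?thesis using x0 cases by auto
  qed
  then show ?thesis by (auto simp: atoms_below_def)
qed

lemma atoms_below_sup: "atoms_below (sup y z) = atoms_below y \<union> atoms_below z"
proof -
  have "atoms_below (sup y z) = atoms_below (- inf (- y) (- z))" by simp
  also have "\<dots> = atoms_below y \<union> atoms_below z"
    unfolding atoms_below_uminus atoms_below_inf using atoms_below_subset by fastforce
  finally show ?thesis .
qed

text \<open>
  Atoms are completely join-prime in every complete Boolean algebra: an atom that is below no member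
  of \<open>Y\<close> is disjoint from each of them, so its complement is an upper bound of \<open>Y\<close>.
\<close>

lemma atoms_below_Sup:
  fixes Y :: "'b::{complete_lattice, boolean_algebra} set"
  shows "atoms_below (Sup Y) = (\<Union>y\<in>Y. atoms_below y)"
proof
  show "(\<Union>y\<in>Y. atoms_below y) \<subseteq> atoms_below (Sup Y)"
    by (auto simp: atoms_below_def intro: Sup_upper2)
  show "atoms_below (Sup Y) \<subseteq> (\<Union>y\<in>Y. atoms_below y)"
  proof
    fix x assume x: "x \<in> atoms_below (Sup Y)"
    show "x \<in> (\<Union>y\<in>Y. atoms_below y)"
    proof (rule ccontr)
      assume no: "x \<notin> (\<Union>y\<in>Y. atoms_below y)"
      have "y \<le> - x" if "y \<in> Y" for y
      proof -
        have "x \<in> atoms_below (- y)"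
          using x no that atoms_below_subset by (auto simp: atoms_below_uminus)
        then show ?thesis by (simp add: atoms_below_def le_imp_neg_le compl_le_swap1)
      qed
      then have "Sup Y \<le> - x" by (rule Sup_least)
      then have "x \<in> atoms_below (- x)"
        using x by (auto simp: atoms_below_def)
      then show False
        using x by (auto simp: atoms_below_uminus) (auto simp: atoms_below_def)
    qed
  qed
qed

lemma le_iff_atoms_below_subset:
  fixes y z :: "'b::boolean_algebra"
  assumes "atomic_algebra TYPE('b)"
  shows "y \<le> z \<longleftrightarrow> atoms_below y \<subseteq> atoms_below z"
proof
  assume "y \<le> z"
  then show "atoms_below y \<subseteq> atoms_below z" by (auto simp: atoms_below_def)
next
  assume sub: "atoms_below y \<subseteq> atoms_below z"
  have "atoms_below (inf y (- z)) = {}"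
    using sub by (auto simp: atoms_below_inf atoms_below_uminus)
  then have "inf y (- z) = bot"
    using assms unfolding atomic_algebra_def atoms_below_def by blast
  then show "y \<le> z" by (simp add: inf_shunt)
qed

section \<open>The proximity below a fixed element\<close>

context de_vries_algebra
begin

lemma bot_prec: "bot \<prec> b"
  using DV3[OF order_refl DV5[OF DV1], of b] by simp

lemma sup_prec:
  assumes "a \<prec> c" "b \<prec> c"
  shows "sup a b \<prec> c"
  using DV5[OF DV4[OF DV5[OF assms(1)] DV5[OF assms(2)]]] by simp

lemma finite_Sup_prec: "finite T \<Longrightarrow> (\<And>t. t \<in> T \<Longrightarrow> t \<prec> b) \<Longrightarrow> Sup T \<prec> b"
  by (induction T rule: finite_induct) (auto simp: bot_prec sup_prec)

end

section \<open>The space of atoms of a de Vries extension\<close>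

context de_vries_extension
begin

lemma Sup_image_le: "Sup (\<alpha> ` T) \<le> \<alpha> (Sup T)"
  by (auto intro: Sup_least mono Sup_upper)

lemma le_reflect: "\<alpha> a \<le> \<alpha> b \<Longrightarrow> a \<le> b"
proof -
  assume "\<alpha> a \<le> \<alpha> b"
  then have "\<alpha> (inf a b) = \<alpha> a" by (simp add: M2 inf.absorb1)
  then have "inf a b = a" using inj by (rule injD[rotated])
  then show "a \<le> b" by (simp add: inf.absorb_iff1)
qed

text \<open>
  \<open>- \<alpha> (- a)\<close> is the closure of \<open>\<alpha> a\<close>; the next two lemmas place it between \<open>\<alpha> a\<close> and every
  \<open>\<alpha> b\<close> with \<open>a \<prec> b\<close>.
\<close>

lemma le_closure: "\<alpha> a \<le> - \<alpha> (- a)"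
  by (simp add: inf_shunt[symmetric] M2[symmetric] M1)

lemma closure_le_if_prec: "a \<prec>\<^sub>A b \<Longrightarrow> - \<alpha> (- a) \<le> \<alpha> b"
  using M3 B.DV2 by blast

lemma closure_mono: "a \<le> b \<Longrightarrow> - \<alpha> (- a) \<le> - \<alpha> (- b)"
  by (simp add: mono)

lemma closure_sup: "- \<alpha> (- sup a b) = sup (- \<alpha> (- a)) (- \<alpha> (- b))"
  by (simp add: M2)

text \<open>
  The end of an atom \<open>x\<close> contains \<open>a\<close> iff \<open>x \<le> \<alpha> c\<close> for some \<open>c \<prec> a\<close>; since atoms are completely
  join-prime, M4 collapses this to \<open>x \<le> \<alpha> a\<close>.
\<close>

lemma mem_dual_map_iff: "x \<in> atoms \<Longrightarrow> a \<in> dual_map precA \<alpha> x \<longleftrightarrow> x \<in> atoms_below (\<alpha> a)"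
  by (subst M4) (auto simp: dual_map_def atoms_below_Sup, auto simp: atoms_below_def)

lemma openin_atom_space:
  "openin (atom_space precA \<alpha>) U \<longleftrightarrow> (\<exists>S. U = (\<Union>a\<in>S. atoms_below (\<alpha> a)))"
proof -
  have "dual_map precA \<alpha> -` (\<Union>a\<in>S. zeta precA a) \<inter> atoms = (\<Union>a\<in>S. atoms_below (\<alpha> a))" for S
    using mem_dual_map_iff dual_map_in_ends atoms_below_subset by (fastforce simp: zeta_def)
  then show ?thesis
    unfolding atom_space_def openin_pullback_topology openin_end_space by metis
qed

lemma openin_atoms_below: "openin (atom_space precA \<alpha>) (atoms_below (\<alpha> a))"
  unfolding openin_atom_space by (rule exI[of _ "{a}"]) simp

lemma closedin_atoms_below: "closedin (atom_space precA \<alpha>) (atoms_below (- \<alpha> a))"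
  unfolding closedin_def topspace_atom_space atoms_below_uminus
  using openin_atoms_below[of a] by (simp add: double_diff[OF atoms_below_subset order_refl])

section \<open>Compact elements\<close>

text \<open>
  In both directions a family \<open>S\<close> with \<open>- \<alpha> (- a) \<le> Sup (\<alpha> ` S)\<close> is read as a cover by basic open
  sets; an arbitrary open cover is replaced by all the basic sets contained in one of its members.
\<close>

lemma compact_element_iff_compactin:
  "a \<in> compact_elements \<alpha> \<longleftrightarrow> compactin (atom_space precA \<alpha>) (atoms_below (- \<alpha> (- a)))"
    (is "_ \<longleftrightarrow> compactin ?X ?C")
proof -
  have cover: "- \<alpha> (- a) \<le> Sup (\<alpha> ` S) \<longleftrightarrow> ?C \<subseteq> (\<Union>s\<in>S. atoms_below (\<alpha> s))" for S
    unfolding le_iff_atoms_below_subset[OF atomic] atoms_below_Sup by simp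
  show ?thesis
  proof
    assume "a \<in> compact_elements \<alpha>"
    then have fin: "\<And>S. ?C \<subseteq> (\<Union>s\<in>S. atoms_below (\<alpha> s)) \<Longrightarrow>
        \<exists>T\<subseteq>S. finite T \<and> ?C \<subseteq> (\<Union>s\<in>T. atoms_below (\<alpha> s))"
      unfolding compact_elements_def mem_Collect_eq cover by blast
    show "compactin ?X ?C"
      unfolding compactin_def
    proof (intro conjI allI impI)
      show "?C \<subseteq> topspace ?X" by (simp add: topspace_atom_space atoms_below_subset)
    next
      fix \<U> assume U: "Ball \<U> (openin ?X) \<and> ?C \<subseteq> \<Union>\<U>"
      let ?S = "{s. \<exists>V\<in>\<U>. atoms_below (\<alpha> s) \<subseteq> V}"
      have "\<Union>\<U> \<subseteq> (\<Union>s\<in>?S. atoms_below (\<alpha> s))"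
      proof
        fix x assume "x \<in> \<Union>\<U>"
        then obtain V where V: "V \<in> \<U>" "x \<in> V" by blast
        then have "openin ?X V" using U by blast
        then obtain R where R: "V = (\<Union>r\<in>R. atoms_below (\<alpha> r))"
          unfolding openin_atom_space by (rule exE)
        then obtain r where r: "r \<in> R" "x \<in> atoms_below (\<alpha> r)" using V(2) by auto
        have "r \<in> ?S" using V(1) R r(1) by auto
        then show "x \<in> (\<Union>s\<in>?S. atoms_below (\<alpha> s))" using r(2) by (rule UN_I)
      qed
      then obtain T where T: "T \<subseteq> ?S" "finite T" "?C \<subseteq> (\<Union>s\<in>T. atoms_below (\<alpha> s))"
        using fin[of ?S] U by blast
      then have "\<forall>s\<in>T. \<exists>V\<in>\<U>. atoms_below (\<alpha> s) \<subseteq> V" by blast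
      then obtain V where V: "\<forall>s\<in>T. V s \<in> \<U> \<and> atoms_below (\<alpha> s) \<subseteq> V s" by metis
      then have "?C \<subseteq> \<Union>(V ` T)" using T(3) by blast
      then show "\<exists>\<F>. finite \<F> \<and> \<F> \<subseteq> \<U> \<and> ?C \<subseteq> \<Union>\<F>"
        using V T(2) by (intro exI[of _ "V ` T"]) auto
    qed
  next
    assume comp: "compactin ?X ?C"
    have "\<exists>T\<subseteq>S. finite T \<and> ?C \<subseteq> (\<Union>s\<in>T. atoms_below (\<alpha> s))"
      if "?C \<subseteq> (\<Union>s\<in>S. atoms_below (\<alpha> s))" for S
    proof -
      let ?O = "\<lambda>s. atoms_below (\<alpha> s)"
      have "openin ?X U" if "U \<in> ?O ` S" for U
        using that openin_atoms_below by auto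
      from compactinD[OF comp this \<open>?C \<subseteq> (\<Union>s\<in>S. ?O s)\<close>]
      obtain \<F> where F: "finite \<F>" "\<F> \<subseteq> ?O ` S" "?C \<subseteq> \<Union>\<F>" by auto
      obtain T where "T \<subseteq> S" "finite T" "\<F> = ?O ` T"
        using finite_subset_image[OF F(1,2)] by auto
      then show ?thesis using F(3) by auto
    qed
    then show "a \<in> compact_elements \<alpha>"
      unfolding compact_elements_def mem_Collect_eq cover by blast
  qed
qed

lemma lattice_ideal_compact_elements: "lattice_ideal (compact_elements \<alpha>)"
  unfolding lattice_ideal_def
proof (intro conjI ballI allI impI)
  have "bot \<in> compact_elements \<alpha>"
    unfolding compact_elements_def using top by auto
  then show "compact_elements \<alpha> \<noteq> {}" by blast
next
  fix a b assume "b \<in> compact_elements \<alpha>" "a \<le> b"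
  then show "a \<in> compact_elements \<alpha>"
    unfolding compact_element_iff_compactin
    using closed_compactin[OF _ _ closedin_atoms_below] closure_mono
      le_iff_atoms_below_subset[OF atomic] by blast
next
  fix a b assume "a \<in> compact_elements \<alpha>" "b \<in> compact_elements \<alpha>"
  then show "sup a b \<in> compact_elements \<alpha>"
    unfolding compact_element_iff_compactin closure_sup atoms_below_sup
    by (rule compactin_Un)
qed

text \<open>
  The converse of \<open>closure_le_if_prec\<close> for compact \<open>a\<close>: by M4 the elements \<open>c \<prec> b\<close> cover
  \<open>- \<alpha> (- a)\<close>, and the join \<open>t\<close> of a finite subcover satisfies \<open>a \<le> t \<prec> b\<close>.
\<close>

lemma compact_element_prec:
  assumes a: "a \<in> compact_elements \<alpha>" and le: "- \<alpha> (- a) \<le> \<alpha> b"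
  shows "a \<prec>\<^sub>A b"
proof -
  have "- \<alpha> (- a) \<le> Sup (\<alpha> ` {c. c \<prec>\<^sub>A b})" using le M4[of b] by simp
  then obtain T where T: "T \<subseteq> {c. c \<prec>\<^sub>A b}" "finite T" "- \<alpha> (- a) \<le> Sup (\<alpha> ` T)"
    using a unfolding compact_elements_def by blast
  have "\<alpha> a \<le> \<alpha> (Sup T)"
    by (rule order_trans[OF le_closure order_trans[OF T(3) Sup_image_le]])
  then have "a \<le> Sup T" by (rule le_reflect)
  moreover have "Sup T \<prec>\<^sub>A b" using T by (intro A.finite_Sup_prec) auto
  ultimately show ?thesis using A.DV3 by blast
qed

section \<open>Local compactness and the compact elements\<close>

text \<open>
  A compact neighbourhood \<open>K\<close> of an atom below \<open>\<alpha> b\<close> contains a basic neighbourhood, given by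
  some \<open>a\<close>.  Shrinking to \<open>c \<prec> a \<sqinter> b\<close> puts the closure of \<open>\<alpha> c\<close> inside \<open>K\<close>, where a closed set
  is compact.
\<close>

lemma locally_compact_imp_Sup_compact:
  assumes "locally_compact_space (atom_space precA \<alpha>)"
  shows "\<alpha> b = Sup (\<alpha> ` {a \<in> compact_elements \<alpha>. a \<prec>\<^sub>A b})"
proof (rule antisym)
  show "Sup (\<alpha> ` {a \<in> compact_elements \<alpha>. a \<prec>\<^sub>A b}) \<le> \<alpha> b"
    by (auto intro!: Sup_least mono A.DV2)
  show "\<alpha> b \<le> Sup (\<alpha> ` {a \<in> compact_elements \<alpha>. a \<prec>\<^sub>A b})"
    unfolding le_iff_atoms_below_subset[OF atomic] atoms_below_Sup
  proof
    fix x assume x: "x \<in> atoms_below (\<alpha> b)"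
    then have "x \<in> topspace (atom_space precA \<alpha>)"
      using atoms_below_subset by (auto simp: topspace_atom_space)
    then obtain U K where UK: "openin (atom_space precA \<alpha>) U" "compactin (atom_space precA \<alpha>) K"
        "x \<in> U" "U \<subseteq> K"
      using assms unfolding locally_compact_space_def by blast
    obtain S where "U = (\<Union>a\<in>S. atoms_below (\<alpha> a))"
      using UK(1) openin_atom_space by blast
    then obtain a where a: "x \<in> atoms_below (\<alpha> a)" "atoms_below (\<alpha> a) \<subseteq> K"
      using UK by blast
    have "x \<in> atoms_below (\<alpha> (inf a b))"
      using a x by (simp add: M2 atoms_below_inf)
    then obtain c where c: "c \<prec>\<^sub>A inf a b" "x \<in> atoms_below (\<alpha> c)"
      unfolding M4[of "inf a b"] atoms_below_Sup by auto
    have ca: "c \<prec>\<^sub>A a" and cb: "c \<prec>\<^sub>A b"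
      using A.DV3[OF order_refl c(1)] by simp_all
    have "atoms_below (- \<alpha> (- c)) \<subseteq> K"
      using closure_le_if_prec[OF ca] a(2) le_iff_atoms_below_subset[OF atomic] by blast
    then have "c \<in> compact_elements \<alpha>"
      unfolding compact_element_iff_compactin
      using closed_compactin[OF UK(2) _ closedin_atoms_below] by blast
    then show "x \<in> (\<Union>y\<in>\<alpha> ` {a \<in> compact_elements \<alpha>. a \<prec>\<^sub>A b}. atoms_below y)"
      using c(2) cb by blast
  qed
qed

text \<open>
  A finite subcover of \<open>- \<alpha> (- a)\<close> by compact elements has a compact join, because these form an
  ideal; it is the element above \<open>a\<close> that roundness asks for.
\<close>

lemma round_ideal_compact_elements:
  assumes "Sup (\<alpha> ` compact_elements \<alpha>) = top"
  shows "round_ideal precA (compact_elements \<alpha>)"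
  unfolding round_ideal_def
proof (intro conjI ballI lattice_ideal_compact_elements)
  fix a assume a: "a \<in> compact_elements \<alpha>"
  have "- \<alpha> (- a) \<le> Sup (\<alpha> ` compact_elements \<alpha>)" using assms by simp
  then obtain T where T: "T \<subseteq> compact_elements \<alpha>" "finite T" "- \<alpha> (- a) \<le> Sup (\<alpha> ` T)"
    using a unfolding compact_elements_def by blast
  have "Sup T \<in> compact_elements \<alpha>"
    using T(2,1)
  proof (induction T rule: finite_induct)
    case empty
    show ?case
      using a lattice_ideal_compact_elements unfolding lattice_ideal_def by auto
  next
    case (insert t T)
    then show ?case
      using lattice_ideal_compact_elements unfolding lattice_ideal_def by auto
  qed
  moreover have "a \<prec>\<^sub>A Sup T"
    by (rule compact_element_prec[OF a order_trans[OF T(3) Sup_image_le]])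
  ultimately show "\<exists>t\<in>compact_elements \<alpha>. a \<prec>\<^sub>A t" by blast
qed

text \<open>
  The basic open sets of compact elements cover the space, and the compact set
  \<open>atoms_below (- \<alpha> (- a))\<close> is a neighbourhood of each point of \<open>atoms_below (\<alpha> a)\<close>.
\<close>

lemma Sup_compact_eq_top_imp_locally_compact:
  assumes "Sup (\<alpha> ` compact_elements \<alpha>) = top"
  shows "locally_compact_space (atom_space precA \<alpha>)"
  unfolding locally_compact_space_def topspace_atom_space
proof
  fix x :: 'b assume "x \<in> atoms"
  then have "x \<in> atoms_below (Sup (\<alpha> ` compact_elements \<alpha>))"
    by (simp add: assms atoms_below_def)
  then obtain a where a: "a \<in> compact_elements \<alpha>" "x \<in> atoms_below (\<alpha> a)"
    unfolding atoms_below_Sup by blast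
  moreover have "atoms_below (\<alpha> a) \<subseteq> atoms_below (- \<alpha> (- a))"
    using le_closure[of a] unfolding le_iff_atoms_below_subset[OF atomic] .
  ultimately show "\<exists>U K. openin (atom_space precA \<alpha>) U \<and> compactin (atom_space precA \<alpha>) K \<and>
      x \<in> U \<and> U \<subseteq> K"
    using openin_atoms_below[of a] compact_element_iff_compactin[of a] by metis
qed

lemma Sup_compact_eq_top:
  assumes "\<alpha> top = Sup (\<alpha> ` {a \<in> compact_elements \<alpha>. a \<prec>\<^sub>A top})"
  shows "Sup (\<alpha> ` compact_elements \<alpha>) = top"
proof -
  have "top = Sup (\<alpha> ` {a \<in> compact_elements \<alpha>. a \<prec>\<^sub>A top})"
    using assms unfolding top .
  also have "\<dots> \<le> Sup (\<alpha> ` compact_elements \<alpha>)"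
    by (rule Sup_subset_mono) auto
  finally have "top \<le> Sup (\<alpha> ` compact_elements \<alpha>)" .
  then show ?thesis by (rule top.extremum_uniqueI)
qed

end

theorem theorem4p3:
  fixes precA :: "'a::{complete_lattice, boolean_algebra} \<Rightarrow> 'a \<Rightarrow> bool"
    and precB :: "'b::{complete_lattice, boolean_algebra} \<Rightarrow> 'b \<Rightarrow> bool"
    and \<alpha> :: "'a \<Rightarrow> 'b"
  assumes "de_vries_extension precA precB \<alpha>"
  shows "(locally_compact_space (atom_space precA \<alpha>) \<longleftrightarrow>
            (\<forall>b. \<alpha> b = Sup (\<alpha> ` {a \<in> compact_elements \<alpha>. precA a b})))
       \<and> ((\<forall>b. \<alpha> b = Sup (\<alpha> ` {a \<in> compact_elements \<alpha>. precA a b})) \<longleftrightarrow>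
            round_ideal precA (compact_elements \<alpha>) \<and> Sup (\<alpha> ` compact_elements \<alpha>) = top)"
proof -
  interpret de_vries_extension precA precB \<alpha> by (fact assms)
  let ?I = "compact_elements \<alpha>"
  let ?lc = "locally_compact_space (atom_space precA \<alpha>)"
  let ?generated = "\<forall>b. \<alpha> b = Sup (\<alpha> ` {a \<in> ?I. precA a b})"
  let ?round = "round_ideal precA ?I \<and> Sup (\<alpha> ` ?I) = top"
  have "?lc \<Longrightarrow> ?generated"
    by (intro allI locally_compact_imp_Sup_compact)
  moreover have "?round" if ?generated
  proof -
    have "Sup (\<alpha> ` ?I) = top" by (rule Sup_compact_eq_top[OF spec[OF that]])
    then show ?thesis by (simp add: round_ideal_compact_elements)
  qed
  moreover have "?round \<Longrightarrow> ?lc"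
    by (rule Sup_compact_eq_top_imp_locally_compact) (rule conjunct2)
  ultimately show ?thesis by argo
qed

end
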